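(* Let $G$ be a connected simple graph with $n\geq 3$ vertices and let $X_G=\sum_{\lambda\vdash n} c_\lambda\,\mathfrak{st}_\lambda$ be the expansion of its chromatic symmetric function in the star basis. Consider the sum of hook star coefficients $$h(G)=2c_{21^{n-2}}+c_{31^{n-3}}+c_{41^{n-4}}+\cdots+c_{(n-2)11}+c_{(n-1)1}+c_n=2c_{21^{n-2}}+\sum_{a=3}^{n}c_{a1^{n-a}}.$$ Then $h(G)=1$ if $G$ is (isomorphic to) the star $\mathrm{St}_n$, and $h(G)=0$ otherwise.
   Context: For a finite simple graph $G=(V,E)$, a proper colouring is a function $\kappa:V\to\{1,2,3,\ldots\}$ with $\kappa(u)\neq\kappa(v)$ whenever $\{u,v\}\in E$. The chromatic symmetric function of $G$ is $X_G=\sum_{\kappa\text{ proper}}\prod_{v\in V}x_{\kappa(v)}$, a symmetric function in commuting variables $x_1,x_2,\ldots$, homogeneous of degree $|V|$. The star $\mathrm{St}_k$ is the $k$-vertex tree in which $k-1$ leaves are joined to a single central vertex ($\mathrm{St}_1$ is a single vertex). For a partition $\lambda=(\lambda_1,\ldots,\lambda_\ell)$ of $n$, $\mathrm{St}_\lambda$ is the disjoint union of $\mathrm{St}_{\lambda_1},\ldots,\mathrm{St}_{\lambda_\ell}$, and $\mathfrak{st}_\lambda=X_{\mathrm{St}_\lambda}$. It is known that $\{\mathfrak{st}_\lambda:\lambda\vdash n\}$ is a basis (over $\mathbb{Q}$) of the space of symmetric functions of degree $n$, called the star basis. The notation $a1^{k}$ denotes the partition with one part $a$ and $k$ parts equal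 to $1$. *)

theory Defs
  imports Complex_Main "HOL-Library.Multiset" "HOL-Library.FuncSet" "Graph_Theory.Graph_Theory"
begin

text \<open>
  Finite simple graphs are the loop-free symmetric pair digraphs of \<^locale>\<open>pair_graph\<close>:
  an undirected edge is represented by its two arcs.
\<close>

text \<open>Colourings are extensional on the vertex set, so that each one is counted only once.\<close>

definition proper_colouring :: "'a pair_pre_digraph \<Rightarrow> ('a \<Rightarrow> nat) \<Rightarrow> bool" where
  "proper_colouring G \<kappa> \<longleftrightarrow>
     \<kappa> \<in> pverts G \<rightarrow>\<^sub>E {1..} \<and> (\<forall>(u, v) \<in> parcs G. \<kappa> u \<noteq> \<kappa> v)"

text \<open>
  A formal power series over the rationals in commuting variables \<open>x\<^sub>1, x\<^sub>2, \<dots>\<close> is given by its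
  coefficient function on monomials; a monomial is the multiset of the indices of its
  variables. In particular, the product of the \<open>x\<^bsub>\<kappa>(v)\<^esub>\<close> over all vertices \<open>v\<close> is the image
  multiset of the vertex set under \<open>\<kappa>\<close>.
\<close>

type_synonym power_series = "nat multiset \<Rightarrow> rat"

definition chromatic_symfun :: "'a pair_pre_digraph \<Rightarrow> power_series" where
  "chromatic_symfun G m =
     of_nat (card {\<kappa>. proper_colouring G \<kappa> \<and> image_mset \<kappa> (mset_set (pverts G)) = m})"

definition star_graph :: "nat \<Rightarrow> nat pair_pre_digraph" where
  "star_graph k = \<lparr> pverts = {..<k}, parcs = (\<Union>j\<in>{1..<k}. {(0, j), (j, 0)}) \<rparr>"

definition disjoint_union :: "'a pair_pre_digraph list \<Rightarrow> (nat \<times> 'a) pair_pre_digraph" where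
  "disjoint_union Gs =
     \<lparr> pverts = {(i, v). i < length Gs \<and> v \<in> pverts (Gs ! i)},
       parcs = {((i, u), (i, v)) | i u v. i < length Gs \<and> (u, v) \<in> parcs (Gs ! i)} \<rparr>"

text \<open>Partitions are weakly decreasing lists of positive parts.\<close>

definition partitions :: "nat \<Rightarrow> nat list set" where
  "partitions n = {lam. sorted_wrt (\<ge>) lam \<and> 0 \<notin> set lam \<and> sum_list lam = n}"

definition star_symfun :: "nat list \<Rightarrow> power_series" where
  "star_symfun lam = chromatic_symfun (disjoint_union (map star_graph lam))"

text \<open>The partition \<open>a1\<^sup>k\<close>.\<close>

definition hook :: "nat \<Rightarrow> nat \<Rightarrow> nat list" where
  "hook a k = a # replicate k 1"

lemma hook_in_partitions: "1 \<le> a \<Longrightarrow> a \<le> n \<Longrightarrow> hook a (n - a) \<in> partitions n"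
  by (auto simp: hook_def partitions_def sorted_wrt_iff_nth_less nth_Cons sum_list_replicate
      split: nat.splits)

lemma length_le_sum_list: "0 \<notin> set lam \<Longrightarrow> length lam \<le> sum_list (lam :: nat list)"
  by (induction lam) auto

lemma finite_partitions: "finite (partitions n)"
proof (rule finite_subset)
  show "partitions n \<subseteq> {lam. set lam \<subseteq> {..n} \<and> length lam \<le> n}"
    by (auto simp: partitions_def length_le_sum_list member_le_sum_list)
qed (rule finite_lists_length_le, simp)

lemma pair_graph_star_graph: "pair_graph (star_graph k)"
  by unfold_locales (auto simp: star_graph_def symmetric_def sym_def)

end

theory Submission
  imports Defs
begin

text \<open>
  Compare the coefficients of \<open>x\<^sub>1\<^bsup>n-1\<^esup> x\<^sub>2\<close> on both sides of the expansion. A proper colouring with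
  exactly one vertex of colour 2 and all others of colour 1 is the choice of a vertex \<open>v\<close> whose
  removal leaves no edge. For a graph with \<open>n\<close> vertices the coefficient is therefore the
  number of vertices that cover all edges (\<open>chromatic_symfun_one_vertex_apart\<close>).

  For \<open>St\<^sub>\<lambda>\<close> this number is \<open>n\<close> if \<open>\<lambda> = 1\<^sup>n\<close>, it is 2 if \<open>\<lambda> = 21\<^bsup>n-2\<^esup>\<close> (both ends of the only
  edge), it is 1 if \<open>\<lambda> = a1\<^bsup>n-a\<^esup>\<close> with \<open>a \<ge> 3\<close> (the centre), and it is 0 if \<open>\<lambda>\<close> has two parts
  greater than 1, because no vertex meets edges of two components. Hence the coefficient of
  \<open>x\<^sub>1\<^bsup>n-1\<^esup> x\<^sub>2\<close> in \<open>X\<^sub>G\<close> is \<open>h(G) + n c\<close>, where \<open>c\<close> belongs to the partition \<open>1\<^sup>n\<close>. The last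
  term vanishes: the coefficient of \<open>x\<^sub>1\<^sup>n\<close> is 1 for an edgeless graph and 0 for every other graph, so
  comparing these coefficients gives \<open>c = 0\<close> (\<open>chromatic_symfun_constant\<close>).

  It remains to see that a connected graph with at least three vertices has exactly one
  vertex covering all edges if it is a star, and none otherwise
  (\<open>digraph_iso_star_iff\<close>, \<open>card_covering_vertices_le_1\<close>).
\<close>

section \<open>Two coefficients of the chromatic symmetric function\<close>

lemma proper_colouringD:
  assumes "proper_colouring H \<kappa>"
  shows "\<kappa> \<in> extensional (pverts H)" and "(u, w) \<in> parcs H \<Longrightarrow> \<kappa> u \<noteq> \<kappa> w"
  using assms by (auto simp: proper_colouring_def PiE_def)

text \<open>
  The monomial \<open>x\<^sub>1\<^bsup>|V|\<^esup>\<close> only comes from the constant colouring, which every edge violates.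
\<close>

lemma chromatic_symfun_constant:
  assumes "finite (pverts H)" and "pair_wf_digraph H"
  shows "chromatic_symfun H (replicate_mset (card (pverts H)) 1) = (if parcs H = {} then 1 else 0)"
proof -
  interpret pair_wf_digraph H by fact
  let ?m = "replicate_mset (card (pverts H)) 1 :: nat multiset"
  let ?one = "restrict (\<lambda>_. 1) (pverts H) :: _ \<Rightarrow> nat"
  let ?C = "{\<kappa>. proper_colouring H \<kappa> \<and> image_mset \<kappa> (mset_set (pverts H)) = ?m}"
  have one: "\<kappa> = ?one" if "\<kappa> \<in> ?C" for \<kappa>
  proof
    fix x
    have "set_mset (image_mset \<kappa> (mset_set (pverts H))) \<subseteq> {1}"
      using that by auto
    then show "\<kappa> x = ?one x"
      using that assms(1) proper_colouringD(1)[of H \<kappa>] by (auto simp: extensional_def)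
  qed
  have mset: "image_mset ?one (mset_set (pverts H)) = ?m"
  proof -
    have "image_mset ?one (mset_set (pverts H)) = image_mset (\<lambda>_. 1) (mset_set (pverts H))"
      using assms(1) by (intro image_mset_cong) auto
    then show ?thesis by (simp add: image_mset_const_eq)
  qed
  have "?C = (if parcs H = {} then {?one} else {})"
  proof (cases "parcs H = {}")
    case True
    then have "?one \<in> ?C" using mset by (auto simp: proper_colouring_def)
    then show ?thesis unfolding if_P[OF True] using one by blast
  next
    case False
    then obtain u w where uw: "(u, w) \<in> parcs H" by auto
    have "?C = {}"
    proof (rule equals0I)
      fix \<kappa> assume k: "\<kappa> \<in> ?C"
      then have "\<kappa> u \<noteq> \<kappa> w" using proper_colouringD(2)[OF _ uw] by blast
      then show False using one[OF k] in_arcsD1[OF uw] in_arcsD2[OF uw] by simp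
    qed
    then show ?thesis unfolding if_not_P[OF False] .
  qed
  then show ?thesis by (simp add: chromatic_symfun_def)
qed

definition covering_vertices :: "'a pair_pre_digraph \<Rightarrow> 'a set" where
  "covering_vertices H = {v \<in> pverts H. \<forall>(u, w)\<in>parcs H. u = v \<or> w = v}"

text \<open>
  The monomial forces a single vertex \<open>v\<close> of colour 2. An edge that avoids \<open>v\<close> has two ends of
  colour 1, whereas an edge at \<open>v\<close> has ends of different colours because it is not a loop. So the
  proper colourings correspond to the vertices that meet every edge.
\<close>

lemma chromatic_symfun_one_vertex_apart:
  assumes "finite (pverts H)" and "pair_loopfree_digraph H"
  shows "chromatic_symfun H (add_mset 2 (replicate_mset (card (pverts H) - 1) 1))
           = of_nat (card (covering_vertices H))"
proof -
  interpret pair_loopfree_digraph H by fact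
  let ?V = "pverts H"
  let ?m = "add_mset 2 (replicate_mset (card ?V - 1) 1) :: nat multiset"
  let ?k = "\<lambda>v. restrict (\<lambda>x. if x = v then 2 else 1) ?V :: _ \<Rightarrow> nat"
  let ?C = "{\<kappa>. proper_colouring H \<kappa> \<and> image_mset \<kappa> (mset_set ?V) = ?m}"
  have proper_iff: "proper_colouring H (?k v) \<longleftrightarrow> v \<in> covering_vertices H" if "v \<in> ?V" for v
  proof -
    have "?k v u \<noteq> ?k v w \<longleftrightarrow> u = v \<or> w = v" if "(u, w) \<in> parcs H" for u w
      using no_loops'[OF that] in_arcsD1[OF that] in_arcsD2[OF that] by auto
    moreover have "?k v \<in> ?V \<rightarrow>\<^sub>E {1..}" by auto
    ultimately show ?thesis
      using that unfolding proper_colouring_def covering_vertices_def by blast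
  qed
  have mset: "image_mset (?k v) (mset_set ?V) = ?m" if v: "v \<in> ?V" for v
  proof -
    have "mset_set ?V = add_mset v (mset_set (?V - {v}))"
      using assms(1) v by (simp add: mset_set.remove)
    moreover have "image_mset (?k v) (mset_set (?V - {v})) = image_mset (\<lambda>_. 1) (mset_set (?V - {v}))"
      using assms(1) by (intro image_mset_cong) auto
    ultimately show ?thesis
      using assms(1) v by (simp add: image_mset_const_eq)
  qed
  have shape: "\<exists>v\<in>?V. \<kappa> = ?k v" if k: "\<kappa> \<in> ?C" for \<kappa>
  proof -
    have ext: "\<kappa> \<in> extensional ?V" and im: "image_mset \<kappa> (mset_set ?V) = ?m"
      using k proper_colouringD(1) by auto
    have "count (image_mset \<kappa> (mset_set ?V)) 2 = card {x \<in> ?V. \<kappa> x = 2}"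
      using assms(1) by (simp add: count_image_mset' Int_def vimage_def conj_commute)
    then have "card {x \<in> ?V. \<kappa> x = 2} = 1" using im by simp
    then obtain v where v: "{x \<in> ?V. \<kappa> x = 2} = {v}" by (rule card_1_singletonE)
    have "\<kappa> ` ?V = set_mset ?m" using arg_cong[OF im, of set_mset] assms(1) by simp
    then have "\<kappa> ` ?V \<subseteq> {1, 2}" by auto
    then have "\<kappa> = ?k v" using v ext by (fastforce simp: extensional_def)
    then show ?thesis using v by auto
  qed
  have "?C = ?k ` covering_vertices H"
  proof (intro subset_antisym subsetI)
    fix \<kappa> assume k: "\<kappa> \<in> ?C"
    then obtain v where "v \<in> ?V" "\<kappa> = ?k v" using shape by blast
    moreover from this k have "v \<in> covering_vertices H" using proper_iff by blast
    ultimately show "\<kappa> \<in> ?k ` covering_vertices H" by blast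
  next
    fix \<kappa> assume "\<kappa> \<in> ?k ` covering_vertices H"
    then obtain v where v: "v \<in> covering_vertices H" "\<kappa> = ?k v" by blast
    then have "v \<in> ?V" by (simp add: covering_vertices_def)
    then show "\<kappa> \<in> ?C" using v proper_iff mset by blast
  qed
  moreover have "inj_on ?k (covering_vertices H)"
  proof (rule inj_onI)
    fix v w assume "v \<in> covering_vertices H" "w \<in> covering_vertices H" "?k v = ?k w"
    then show "v = w" by (auto simp: covering_vertices_def dest!: fun_cong[of _ _ v] split: if_splits)
  qed
  ultimately show ?thesis by (simp add: chromatic_symfun_def card_image)
qed

section \<open>Covering vertices of disjoint unions of stars\<close>

lemma star_arc_iff: "(u, w) \<in> parcs (star_graph k) \<longleftrightarrow>
    (u = 0 \<and> 1 \<le> w \<and> w < k) \<or> (w = 0 \<and> 1 \<le> u \<and> u < k)"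
  by (auto simp: star_graph_def)

lemma pverts_star [simp]: "pverts (star_graph k) = {..<k}"
  by (simp add: star_graph_def)

abbreviation stars :: "nat list \<Rightarrow> (nat \<times> nat) pair_pre_digraph" where
  "stars lam \<equiv> disjoint_union (map star_graph lam)"

lemma pverts_stars: "pverts (stars lam) = (SIGMA i:{..<length lam}. {..<lam ! i})"
  by (auto simp: disjoint_union_def)

lemma stars_arc_iff: "((i, u), (j, w)) \<in> parcs (stars lam) \<longleftrightarrow>
    i = j \<and> i < length lam \<and> (u, w) \<in> parcs (star_graph (lam ! i))"
  by (auto simp: disjoint_union_def)

lemma finite_pverts_stars: "finite (pverts (stars lam))"
  by (simp add: pverts_stars)

lemma card_pverts_stars: "card (pverts (stars lam)) = sum_list lam"
  by (simp add: pverts_stars sum_list_sum_nth atLeast0LessThan)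

lemma pair_loopfree_digraph_stars: "pair_loopfree_digraph (stars lam)"
  by unfold_locales (auto simp: disjoint_union_def star_arc_iff)

text \<open>The second part decides, since it bounds all later ones.\<close>

lemma partition_hook_or_two_big_parts:
  assumes "lam \<in> partitions n" and "n > 0"
  obtains (hook) a where "1 \<le> a" "a \<le> n" "lam = hook a (n - a)"
  | (big) "1 < length lam" "2 \<le> lam ! 0" "2 \<le> lam ! 1"
proof -
  obtain a mu where lam: "lam = a # mu"
    using assms by (cases lam) (auto simp: partitions_def)
  have pos: "\<forall>x\<in>set (a # mu). 1 \<le> x" and dec: "\<forall>x\<in>set mu. x \<le> a"
      and "sorted_wrt (\<ge>) mu" and sum: "a + sum_list mu = n"
    using assms(1) by (auto simp: lam partitions_def Suc_le_eq intro!: gr0I)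
  show thesis
  proof (cases "\<forall>x\<in>set mu. x = 1")
    case True
    then have mu: "mu = replicate (length mu) 1" by (simp add: replicate_length_same)
    have "sum_list mu = length mu" using True by (induction mu) auto
    then show thesis using hook[of a] pos sum mu by (auto simp: lam hook_def)
  next
    case False
    then obtain b nu where mu: "mu = b # nu" by (cases mu) auto
    have "b \<noteq> 1"
      using False pos \<open>sorted_wrt (\<ge>) mu\<close> by (fastforce simp: mu)
    then show thesis using big pos dec by (auto simp: lam mu)
  qed
qed

text \<open>A covering vertex would have to lie in both of the first two components.\<close>

lemma covering_vertices_two_big_parts:
  assumes "1 < length lam" "2 \<le> lam ! 0" "2 \<le> lam ! 1"
  shows "covering_vertices (stars lam) = {}"
proof (rule equals0I)
  fix v assume v: "v \<in> covering_vertices (stars lam)"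
  have "((i, 0), (i, 1)) \<in> parcs (stars lam)" if "i \<in> {0, 1}" for i
    using that assms by (auto simp: stars_arc_iff star_arc_iff)
  then have "fst v = i" if "i \<in> {0, 1}" for i
    using that v unfolding covering_vertices_def by fastforce
  then show False by (metis insertCI zero_neq_one)
qed

lemma length_hook [simp]: "length (hook a k) = Suc k"
  by (simp add: hook_def)

lemma nth_hook: "i \<le> k \<Longrightarrow> hook a k ! i = (if i = 0 then a else 1)"
  by (cases i) (auto simp: hook_def)

lemma stars_hook_arc_iff: "((i, u), (j, w)) \<in> parcs (stars (hook a k)) \<longleftrightarrow>
    i = 0 \<and> j = 0 \<and> (u, w) \<in> parcs (star_graph a)"
  unfolding stars_arc_iff by (auto simp: nth_hook star_arc_iff split: if_splits)

lemma sum_list_hook: "sum_list (hook a k) = a + k"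
  by (simp add: hook_def sum_list_replicate)

lemma parcs_stars_hook_1: "parcs (stars (hook 1 k)) = {}"
  by (auto simp: stars_hook_arc_iff star_arc_iff)

text \<open>
  The edge from the centre to leaf 1 leaves only its two ends as candidates; if there is a leaf 2,
  the edge to it rules out leaf 1.
\<close>

lemma covering_vertices_hook:
  assumes "2 \<le> a"
  shows "covering_vertices (stars (hook a k)) = {(0, 0)} \<union> (if a = 2 then {(0, 1)} else {})"
proof -
  have "v = (0, 0) \<or> a = 2 \<and> v = (0, 1)" if v: "v \<in> covering_vertices (stars (hook a k))" for v
  proof -
    have cov: "v = (0, 0) \<or> v = (0, w)" if "1 \<le> w" "w < a" for w
    proof -
      have "((0, 0), (0, w)) \<in> parcs (stars (hook a k))"
        using that by (simp add: stars_hook_arc_iff star_arc_iff)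
      then show ?thesis using v unfolding covering_vertices_def by fastforce
    qed
    show ?thesis using cov[of 1] cov[of 2] assms by auto
  qed
  moreover have "(0, 0) \<in> covering_vertices (stars (hook a k))"
    using assms by (auto simp: covering_vertices_def pverts_stars nth_hook stars_hook_arc_iff star_arc_iff)
  moreover have "(0, 1) \<in> covering_vertices (stars (hook 2 k))"
    by (auto simp: covering_vertices_def pverts_stars nth_hook stars_hook_arc_iff star_arc_iff)
  ultimately show ?thesis by auto
qed

lemma card_covering_vertices_hook:
  "1 \<le> a \<Longrightarrow> card (covering_vertices (stars (hook a k))) = (if a = 1 then Suc k else if a = 2 then 2 else 1)"
proof (cases "a = 1")
  case True
  have "covering_vertices (stars (hook 1 k)) = pverts (stars (hook 1 k))"
    by (simp only: covering_vertices_def parcs_stars_hook_1) simp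
  then show ?thesis using True by (simp add: card_pverts_stars sum_list_hook)
qed (simp add: covering_vertices_hook)

text \<open>
  The coefficient of \<open>x\<^sub>1\<^bsup>n-1\<^esup> x\<^sub>2\<close> in a star expansion: only hooks contribute, and apart from
  the term of the hook \<open>1\<^sup>n\<close> it is the sum of hook coefficients under study.
\<close>

lemma sum_covering_vertices:
  fixes c :: "nat list \<Rightarrow> rat"
  assumes "2 \<le> n"
  shows "(\<Sum>lam\<in>partitions n. c lam * of_nat (card (covering_vertices (stars lam))))
           = of_nat n * c (hook 1 (n - 1)) + (2 * c (hook 2 (n - 2)) + (\<Sum>a = 3..n. c (hook a (n - a))))"
proof -
  let ?f = "\<lambda>lam. c lam * of_nat (card (covering_vertices (stars lam)))"
  let ?h = "\<lambda>a. hook a (n - a)"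
  have "sum ?f (partitions n) = sum ?f (?h ` {1..n})"
  proof (rule sum.mono_neutral_right)
    show "\<forall>lam\<in>partitions n - ?h ` {1..n}. ?f lam = 0"
    proof
      fix lam assume lam: "lam \<in> partitions n - ?h ` {1..n}"
      then have "lam \<in> partitions n" "n > 0" using assms by auto
      then show "?f lam = 0"
        using lam by (cases rule: partition_hook_or_two_big_parts)
          (auto simp: covering_vertices_two_big_parts)
    qed
  qed (auto simp: finite_partitions intro: hook_in_partitions)
  also have "\<dots> = (\<Sum>a = 1..n. ?f (?h a))"
    by (subst sum.reindex) (auto simp: inj_on_def hook_def)
  also have "\<dots> = (\<Sum>a = 1..n. c (?h a) * of_nat (if a = 1 then Suc (n - a) else if a = 2 then 2 else 1))"
    by (intro sum.cong) (simp_all add: card_covering_vertices_hook)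
  also have "{1..n} = insert 1 (insert 2 {3..n})" using assms by auto
  finally show ?thesis using assms by (simp add: algebra_simps)
qed

text \<open>
  The coefficient of \<open>x\<^sub>1\<^sup>n\<close> in a star expansion isolates \<open>1\<^sup>n\<close>, the only partition whose
  stars have no edge.
\<close>

lemma sum_edgeless:
  fixes c :: "nat list \<Rightarrow> rat"
  assumes "1 \<le> n"
  shows "(\<Sum>lam\<in>partitions n. c lam * (if parcs (stars lam) = {} then 1 else 0)) = c (hook 1 (n - 1))"
proof -
  have edge: "parcs (stars lam) \<noteq> {}" if "lam \<in> partitions n" "lam \<noteq> hook 1 (n - 1)" for lam
  proof -
    have "0 < n" using assms by simp
    with that(1) have "2 \<le> lam ! 0 \<and> 0 < length lam"
    proof (cases rule: partition_hook_or_two_big_parts)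
      case (hook a)
      moreover have "a \<noteq> 1" using hook that(2) by blast
      ultimately show ?thesis by (simp add: nth_hook)
    qed auto
    then have "((0, 0), (0, 1)) \<in> parcs (stars lam)" by (simp add: stars_arc_iff star_arc_iff)
    then show ?thesis by blast
  qed
  have "(\<Sum>lam\<in>partitions n. c lam * (if parcs (stars lam) = {} then 1 else 0))
      = (\<Sum>lam\<in>{hook 1 (n - 1)}. c lam * (if parcs (stars lam) = {} then 1 else 0))"
    using edge assms
    by (intro sum.mono_neutral_right) (auto simp: finite_partitions intro: hook_in_partitions)
  then show ?thesis using parcs_stars_hook_1[of "n - 1"] by simp
qed

section \<open>Covering vertices of connected graphs\<close>

lemma (in pair_graph) connected_imp_neighbour:
  assumes "Digraph_Component.connected (with_proj G)" and "2 \<le> card (pverts G)" and "u \<in> pverts G"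
  obtains w where "(u, w) \<in> parcs G"
proof -
  have "strongly_connected (with_proj G)"
    using assms(1) pair_sym_arcs by (intro symmetric_connected_imp_strongly_connected)
  moreover obtain v where "v \<in> pverts G" "v \<noteq> u"
    using assms(2,3) by (metis card_le_Suc0_iff_eq not_less_eq_eq numeral_2_eq_2 pair_finite_verts)
  ultimately have "u \<rightarrow>\<^sup>*\<^bsub>with_proj G\<^esub> v" using assms(3) by (auto simp: strongly_connected_def)
  then show thesis using that \<open>v \<noteq> u\<close> by (cases rule: converse_reachable_cases) auto
qed

text \<open>By connectedness every other vertex has a neighbour, which can only be the covering vertex.\<close>

lemma (in pair_graph) parcs_eq_star_at_cover:
  assumes "Digraph_Component.connected (with_proj G)" and "2 \<le> card (pverts G)"
    and "v \<in> covering_vertices G"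
  shows "parcs G = (\<Union>x\<in>pverts G - {v}. {(v, x), (x, v)})"
proof -
  have into: "(x, v) \<in> parcs G" if "x \<in> pverts G - {v}" for x
  proof -
    have "x \<in> pverts G" using that by blast
    with connected_imp_neighbour[OF assms(1,2)] obtain w where "(x, w) \<in> parcs G" by blast
    then show ?thesis using assms(3) that by (auto simp: covering_vertices_def)
  qed
  show ?thesis
  proof (intro subset_antisym subrelI)
    fix u w assume uw: "(u, w) \<in> parcs G"
    then have "u = v \<or> w = v" using assms(3) by (auto simp: covering_vertices_def)
    then show "(u, w) \<in> (\<Union>x\<in>pverts G - {v}. {(v, x), (x, v)})"
      using no_loops'[OF uw] in_arcsD1[OF uw] in_arcsD2[OF uw] by auto
  next
    fix u w assume "(u, w) \<in> (\<Union>x\<in>pverts G - {v}. {(v, x), (x, v)})"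
    then obtain x where x: "x \<in> pverts G - {v}" and "(u, w) = (v, x) \<or> (u, w) = (x, v)" by blast
    moreover have "(v, x) \<in> parcs G" using into[OF x] arcs_symmetric by blast
    ultimately show "(u, w) \<in> parcs G" using into[OF x] by auto
  qed
qed

text \<open>A third vertex is joined to the first cover by an edge that a second one would miss.\<close>

lemma (in pair_graph) card_covering_vertices_le_1:
  assumes "Digraph_Component.connected (with_proj G)" and "3 \<le> card (pverts G)"
  shows "card (covering_vertices G) \<le> 1"
proof -
  have "v = w" if v: "v \<in> covering_vertices G" and w: "w \<in> covering_vertices G" for v w
  proof (rule ccontr)
    assume "v \<noteq> w"
    have "\<not> pverts G \<subseteq> {v, w}"
      using assms(2) \<open>v \<noteq> w\<close> card_mono[of "{v, w}" "pverts G"] by auto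
    then obtain x where x: "x \<in> pverts G" "x \<noteq> v" "x \<noteq> w" by blast
    then have "(x, v) \<in> parcs G" using parcs_eq_star_at_cover[OF assms(1) _ v] assms(2) by auto
    then show False using w x \<open>v \<noteq> w\<close> by (auto simp: covering_vertices_def)
  qed
  moreover have "finite (covering_vertices G)" by (simp add: covering_vertices_def pair_finite_verts)
  ultimately show ?thesis by (simp add: card_le_Suc0_iff_eq)
qed

text \<open>
  An isomorphism transports the centre of the star to a covering vertex. Conversely, around a
  covering vertex the graph already has the edges of a star, so any bijection that sends this
  vertex to 0 is an isomorphism.
\<close>

lemma (in pair_graph) digraph_iso_star_iff:
  assumes "Digraph_Component.connected (with_proj G)" and "card (pverts G) = n" and "2 \<le> n"
  shows "digraph_iso (with_proj G) (with_proj (star_graph n)) \<longleftrightarrow> covering_vertices G \<noteq> {}"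
proof
  assume "digraph_iso (with_proj G) (with_proj (star_graph n))"
  then obtain f where f: "digraph_isomorphism f"
    and star: "with_proj (star_graph n) = app_iso f (with_proj G)"
    unfolding digraph_iso_def by blast
  have "iso_verts f ` pverts G = {..<n}" and arcs: "iso_arcs f ` parcs G = parcs (star_graph n)"
    and proj: "iso_tail f = fst" "iso_head f = snd"
    using arg_cong[OF star, of verts] arg_cong[OF star, of arcs]
      arg_cong[OF star, of tail] arg_cong[OF star, of head] by simp_all
  then obtain v where v: "v \<in> pverts G" "iso_verts f v = 0"
    using assms(3) by (metis (mono_tags) imageE lessThan_iff less_le_trans zero_less_numeral)
  have "u = v \<or> w = v" if uw: "(u, w) \<in> parcs G" for u w
  proof -
    have "iso_arcs f (u, w) = (iso_verts f u, iso_verts f w)"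
      using uw iso_verts_tail[OF f uw] iso_verts_head[OF f uw] proj by (simp add: prod_eq_iff)
    then have "iso_verts f u = 0 \<or> iso_verts f w = 0"
      using arcs uw star_arc_iff by (metis imageI)
    then show ?thesis
      using iso_verts_eq_iff[OF f] v in_arcsD1[OF uw] in_arcsD2[OF uw] by metis
  qed
  then show "covering_vertices G \<noteq> {}" using v by (auto simp: covering_vertices_def)
next
  assume "covering_vertices G \<noteq> {}"
  then obtain v where v: "v \<in> covering_vertices G" by blast
  then have vV: "v \<in> pverts G" by (simp add: covering_vertices_def)
  have "card (pverts G - {v}) = card {1..<n}" using vV assms(2) by (simp add: pair_finite_verts)
  then obtain g where g: "bij_betw g (pverts G - {v}) {1..<n}"
    using finite_same_card_bij pair_finite_verts by (metis finite_Diff finite_atLeastLessThan)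
  define f where "f = g(v := 0)"
  have f: "f v = 0" "f ` (pverts G - {v}) = {1..<n}" "inj_on f (pverts G - {v})"
    using g by (auto simp: f_def bij_betw_def inj_on_def)
  then have inj: "inj_on f (pverts G)" and im: "f ` pverts G = {..<n}"
  proof -
    have V: "pverts G = insert v (pverts G - {v})" using vV by auto
    show "inj_on f (pverts G)"
      by (subst V, subst inj_on_insert) (use f in auto)
    show "f ` pverts G = {..<n}"
      by (subst V, subst image_insert) (use f assms(3) in auto)
  qed
  let ?F = "\<lparr> iso_verts = f, iso_arcs = map_prod f f, iso_head = snd, iso_tail = fst \<rparr>
    :: ('a, 'a \<times> 'a, nat, nat \<times> nat) digraph_isomorphism"
  have "inj_on (map_prod f f) (parcs G)"
    by (rule inj_on_subset[OF map_prod_inj_on[OF inj inj]]) (auto dest: in_arcsD1 in_arcsD2)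
  then have "digraph_isomorphism ?F"
    unfolding digraph_isomorphism_def using inj by (auto intro: wf_digraph)
  moreover have "with_proj (star_graph n) = app_iso ?F (with_proj G)"
  proof -
    have "map_prod f f ` parcs G = (\<Union>x\<in>pverts G - {v}. {(0, f x), (f x, 0)})"
      using parcs_eq_star_at_cover[OF assms(1) _ v] assms(2,3) f(1) by (simp add: image_UN)
    also have "\<dots> = (\<Union>j\<in>f ` (pverts G - {v}). {(0, j), (j, 0)})" by simp
    also have "\<dots> = parcs (star_graph n)" unfolding f(2) by (simp add: star_graph_def)
    finally show ?thesis using im by (simp add: with_proj_def app_iso_def)
  qed
  ultimately show "digraph_iso (with_proj G) (with_proj (star_graph n))"
    unfolding digraph_iso_def by blast
qed

section \<open>The sum of hook star coefficients\<close>

theorem lemma4p1: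
  fixes G :: "'a pair_pre_digraph" and n :: nat and c :: "nat list \<Rightarrow> rat"
  assumes "pair_graph G"
    and "Digraph_Component.connected (with_proj G)"
    and "card (pverts G) = n"
    and "n \<ge> 3"
    and "chromatic_symfun G = (\<lambda>m. \<Sum>lam\<in>partitions n. c lam * star_symfun lam m)"
  shows "2 * c (hook 2 (n - 2)) + (\<Sum>a = 3..n. c (hook a (n - a))) =
         (if digraph_iso (with_proj G) (with_proj (star_graph n)) then 1 else 0)"
proof -
  interpret pair_graph G by fact
  have card: "card (pverts (stars lam)) = n" if "lam \<in> partitions n" for lam
    using that by (simp add: card_pverts_stars partitions_def)
  have "parcs G \<noteq> {}"
  proof -
    obtain u where "u \<in> pverts G" using assms(3,4) by fastforce
    then obtain w where "(u, w) \<in> parcs G"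
      using connected_imp_neighbour assms(2-4) by (metis Suc_leD eval_nat_numeral(3))
    then show ?thesis by blast
  qed
  then have "0 = chromatic_symfun G (replicate_mset n 1)"
    using chromatic_symfun_constant[of G] pair_finite_verts assms(3) by auto
  also have "\<dots> = (\<Sum>lam\<in>partitions n. c lam * (if parcs (stars lam) = {} then 1 else 0))"
  proof -
    have "star_symfun lam (replicate_mset n 1) = (if parcs (stars lam) = {} then 1 else 0)"
      if "lam \<in> partitions n" for lam
      using chromatic_symfun_constant[OF finite_pverts_stars
          pair_loopfree_digraph.axioms(1)[OF pair_loopfree_digraph_stars], of lam] card[OF that]
      by (simp add: star_symfun_def)
    then show ?thesis by (simp add: assms(5) cong: sum.cong)
  qed
  also have "\<dots> = c (hook 1 (n - 1))" using assms(4) by (intro sum_edgeless) simp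
  finally have c1: "c (hook 1 (n - 1)) = 0" by simp
  let ?m = "add_mset 2 (replicate_mset (n - 1) 1) :: nat multiset"
  have "of_nat (card (covering_vertices G)) = chromatic_symfun G ?m"
    using chromatic_symfun_one_vertex_apart[of G] pair_finite_verts assms(3) pair_loopfree_digraph_axioms
    by simp
  also have "\<dots> = (\<Sum>lam\<in>partitions n. c lam * of_nat (card (covering_vertices (stars lam))))"
  proof -
    have "star_symfun lam ?m = of_nat (card (covering_vertices (stars lam)))" if "lam \<in> partitions n" for lam
      using chromatic_symfun_one_vertex_apart[OF finite_pverts_stars pair_loopfree_digraph_stars, of lam]
        card[OF that] by (simp add: star_symfun_def)
    then show ?thesis by (simp add: assms(5) cong: sum.cong)
  qed
  also have "\<dots> = 2 * c (hook 2 (n - 2)) + (\<Sum>a = 3..n. c (hook a (n - a)))"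
    using sum_covering_vertices[of n c] assms(4) c1 by simp
  finally have h: "2 * c (hook 2 (n - 2)) + (\<Sum>a = 3..n. c (hook a (n - a)))
      = of_nat (card (covering_vertices G))" ..
  have "card (covering_vertices G) = (if covering_vertices G = {} then 0 else 1)"
    using card_covering_vertices_le_1 assms(2-4) pair_finite_verts
    by (auto simp: covering_vertices_def le_Suc_eq)
  then show ?thesis
    using h digraph_iso_star_iff assms(2-4) by simp
qed

end
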